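(* Let $d\ge 2$. For all $k\ge1$ let $C_k$ be a $d$-variate copula; let $f_j^{(1)}\equiv1$ on $[0,1]$ and, for $k\ge2$, let $f_j^{(k)}\in\mathcal{F}$, for all $j\in\{1,\dots,d\}$. Define iteratively, for $\boldsymbol{u}=(u_1,\dots,u_d)\in[0,1]^d$, $$\tilde C^{(1)}(\boldsymbol{u})=C_1(\boldsymbol{u}),$$ $$\tilde C^{(k)}(\boldsymbol{u})=C_k\left(\frac{u_1}{f_1^{(k)}(u_1)},\dots,\frac{u_d}{f_d^{(k)}(u_d)}\right)\tilde C^{(k-1)}\big(f_1^{(k)}(u_1),\dots,f_d^{(k)}(u_d)\big),\qquad k\ge2.$$ Then for every $K\ge1$, $\tilde C^{(K)}$ is a Liebscher copula. It can be rewritten, for all $\boldsymbol{u}\in[0,1]^d$, as $$\tilde C^{(K)}(\boldsymbol{u})=\prod_{k=1}^K C_k\big(g_1^{(K-k+1,K)}(u_1),\dots,g_d^{(K-k+1,K)}(u_d)\big),$$ where, for all $j\in\{1,\dots,d\}$ and $K\ge1$, $$g_j^{(1,K)}=\mathrm{Id}/f_j^{(K)},$$ $$g_j^{(k,K)}=\left(\bigodot_{i=K-k+2}^K f_j^{(i)}\right)\Big/\left(\bigodot_{i=K-k+1}^K f_j^{(i)}\right),\qquad k\in\{2,\dots,K\}.$$ Conversely, each $d$-variate Liebscher copula can be built iteratively in this way, i.e. it equals $\tilde C^{(K)}$ for some $K\ge 1$, some $d$-variate copulas $C_1,\dots,C_K$, and some functions $f_j^{(k)}$, $j\in\{1,\dots,d\}$,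 $k\in\{1,\dots,K\}$, with $f_j^{(1)}\equiv1$ on $[0,1]$ and $f_j^{(k)}\in\mathcal{F}$ for $k\in\{2,\dots,K\}$, where $\tilde C^{(K)}$ is obtained from the recursion $\tilde C^{(1)}(\boldsymbol{u})=C_1(\boldsymbol{u})$ and $\tilde C^{(k)}(\boldsymbol{u})=C_k\big(u_1/f_1^{(k)}(u_1),\dots,u_d/f_d^{(k)}(u_d)\big)\,\tilde C^{(k-1)}\big(f_1^{(k)}(u_1),\dots,f_d^{(k)}(u_d)\big)$ for $k\in\{2,\dots,K\}$.
   Context: $\mathrm{Id}$ is the identity function on $[0,1]$. $\mathcal{F}$ is the class of increasing functions $f:[0,1]\to[0,1]$ such that $f(0)=0$, $f(1)=1$ and $\mathrm{Id}/f$ is increasing. Quotients of the form $0/0$ arising at the point $0$ (e.g. $u/f(u)$ at $u=0$) are given the value $0$. "Increasing" is understood in the non-strict sense. For functions $f^{(1)},\dots,f^{(K)}:[0,1]\to[0,1]$, $\bigodot_{k=i}^j f^{(k)}=f^{(i)}\circ\dots\circ f^{(j)}$ if $i\le j$, and $\bigodot_{k=i}^j f^{(k)}=\mathrm{Id}$ otherwise. A Liebscher copula is a copula of the form $$\boldsymbol{u}\in[0,1]^d\mapsto\prod_{k=1}^K C_k\big(g_1^{(k)}(u_1),\dots,g_d^{(k)}(u_d)\big),$$ where $K\ge1$, $C_1,\dots,C_K$ are $d$-variate copulas and $g_j^{(k)}:[0,1]\to[0,1]$ are increasing functions with $g_j^{(k)}(0)=0$, $g_j^{(k)}(1)=1$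 for all $j,k$, satisfying $\prod_{k=1}^K g_j^{(k)}(u)=u$ for all $u\in[0,1]$ and $j\in\{1,\dots,d\}$. *)

theory Defs
  imports "HOL-Probability.Probability"
begin

abbreviation unit_cube :: "(real ^ 'n) set" where
  "unit_cube \<equiv> {u. \<forall>j. u $ j \<in> {0..1}}"

text \<open>A copula is the restriction to the unit cube of the distribution function of a
  probability measure with standard uniform margins. All functions on the cube (or on the unit
  interval) are total here; their values outside are irrelevant.\<close>

definition copula :: "(real ^ 'n \<Rightarrow> real) \<Rightarrow> bool" where
  "copula C \<longleftrightarrow>
    (\<exists>M :: (real ^ 'n) measure.
       prob_space M \<and> sets M = sets borel \<and>
       (\<forall>j. distr M borel (\<lambda>x. x $ j) = uniform_measure lborel {0..1}) \<and>
       (\<forall>u\<in>unit_cube. C u = measure M {x. \<forall>j. x $ j \<le> u $ j}))"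

text \<open>The convention \<open>0 / 0 = 0\<close> is that of HOL division. Positivity of \<open>f\<close> on \<open>(0,1]\<close> is
  what makes \<open>Id / f\<close> a genuine function on \<open>[0,1]\<close>; it has to be required, because \<open>u / 0 = 0\<close>
  in HOL also for \<open>u > 0\<close>, so that monotonicity of the HOL quotient alone would admit functions
  vanishing on an initial interval.\<close>

definition class_F :: "(real \<Rightarrow> real) set" where
  "class_F = {f. f \<in> {0..1} \<rightarrow> {0..1} \<and> mono_on {0..1} f \<and> f 0 = 0 \<and> f 1 = 1 \<and>
                 (\<forall>u\<in>{0<..1}. f u > 0) \<and> mono_on {0..1} (\<lambda>u. u / f u)}"

definition liebscher_copula :: "(real ^ 'n \<Rightarrow> real) \<Rightarrow> bool" where
  "liebscher_copula L \<longleftrightarrow> copula L \<and>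
    (\<exists>K\<ge>1. \<exists>(C :: nat \<Rightarrow> real ^ 'n \<Rightarrow> real) (g :: nat \<Rightarrow> 'n \<Rightarrow> real \<Rightarrow> real).
       (\<forall>k\<in>{1..K}. copula (C k)) \<and>
       (\<forall>k\<in>{1..K}. \<forall>j. g k j \<in> {0..1} \<rightarrow> {0..1} \<and> mono_on {0..1} (g k j) \<and>
          g k j 0 = 0 \<and> g k j 1 = 1) \<and>
       (\<forall>j. \<forall>u\<in>{0..1}. (\<Prod>k=1..K. g k j u) = u) \<and>
       (\<forall>u\<in>unit_cube. L u = (\<Prod>k=1..K. C k (\<chi> j. g k j (u $ j)))))"

text \<open>The recursion starts at index 1; the value at index 0 is a dummy.\<close>

fun iter_copula ::
    "(nat \<Rightarrow> real ^ 'n \<Rightarrow> real) \<Rightarrow> (nat \<Rightarrow> 'n \<Rightarrow> real \<Rightarrow> real) \<Rightarrow> nat \<Rightarrow> real ^ 'n \<Rightarrow> real" where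
  "iter_copula C f 0 u = undefined"
| "iter_copula C f (Suc 0) u = C 1 u"
| "iter_copula C f (Suc (Suc n)) u =
     C (Suc (Suc n)) (\<chi> j. u $ j / f (Suc (Suc n)) j (u $ j)) *
     iter_copula C f (Suc n) (\<chi> j. f (Suc (Suc n)) j (u $ j))"

text \<open>\<open>comp_range h i j\<close> is \<open>h i \<circ> \<dots> \<circ> h j\<close>, and the identity if \<open>j < i\<close>.\<close>

definition comp_range :: "(nat \<Rightarrow> 'a \<Rightarrow> 'a) \<Rightarrow> nat \<Rightarrow> nat \<Rightarrow> 'a \<Rightarrow> 'a" where
  "comp_range h i j = foldr (\<circ>) (map h [i..<Suc j]) id"

definition liebscher_g :: "(nat \<Rightarrow> 'n \<Rightarrow> real \<Rightarrow> real) \<Rightarrow> 'n \<Rightarrow> nat \<Rightarrow> nat \<Rightarrow> real \<Rightarrow> real" where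
  "liebscher_g f j k K = (\<lambda>u.
     if k = 1 then u / f K j u
     else comp_range (\<lambda>i. f i j) (K - k + 2) K u / comp_range (\<lambda>i. f i j) (K - k + 1) K u)"

end

theory Submission
  imports Defs
begin

text \<open>
  Both directions rest on pairs of increasing functions \<open>a, b\<close> of \<open>[0,1]\<close>, fixing \<open>0\<close> and \<open>1\<close>, and on
  their product.

  For the direct part, one step of the recursion multiplies \<open>C (a \<cdot>)\<close> by \<open>D (b \<cdot>)\<close> where
  \<open>a = Id / f\<close> and \<open>b = f\<close>, so \<open>a b = Id\<close>. If \<open>X\<close> and \<open>Y\<close> are independent with distribution functions
  \<open>C\<close> and \<open>D\<close>, the vector with coordinates \<open>max (a\<^sub>j\<^sup>- X\<^sub>j) (b\<^sub>j\<^sup>- Y\<^sub>j)\<close>, built from generalised inverses, has this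
  product as distribution function, and its margins are uniform because \<open>a b = Id\<close>
  (\<open>copula_distorted_mult\<close>). Hence every iterate is a copula by induction. Unrolling the recursion
  composes each earlier factor with the new \<open>f\<close>; this is exactly how the quotients of compositions in
  the product formula change when \<open>K\<close> grows by one (\<open>nested_factor_Suc\<close>), and it
  keeps the product of the factors equal to the identity.

  For the converse, let \<open>P\<^sub>k = g\<^sub>1 \<cdots> g\<^sub>k\<close>, so that \<open>P\<^sub>K = Id\<close>. It suffices to find
  \<open>f\<^sub>k \<in> \<F>\<close> with \<open>f\<^sub>k \<circ> P\<^sub>k = P\<^sub>k\<^sub>-\<^sub>1\<close> for \<open>k \<ge> 2\<close>: then \<open>P\<^sub>k / (f\<^sub>k \<circ> P\<^sub>k) = g\<^sub>k\<close>, and evaluating the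
  recursion at \<open>P\<^sub>k\<close> peels off the factor \<open>C\<^sub>k (g\<^sub>k)\<close>. Such an \<open>f\<^sub>k\<close> exists although \<open>P\<^sub>k\<close> need be
  neither injective nor surjective (\<open>class_F_factorisation\<close>).
\<close>

section \<open>Distortions of the unit interval\<close>

definition distortion :: "(real \<Rightarrow> real) \<Rightarrow> bool" where
  "distortion g \<longleftrightarrow> g \<in> {0..1} \<rightarrow> {0..1} \<and> mono_on {0..1} g \<and> g 0 = 0 \<and> g 1 = 1"

lemma distortionD:
  assumes "distortion g"
  shows "g 0 = 0" "g 1 = 1"
    "\<And>u. 0 \<le> u \<Longrightarrow> u \<le> 1 \<Longrightarrow> 0 \<le> g u" "\<And>u. 0 \<le> u \<Longrightarrow> u \<le> 1 \<Longrightarrow> g u \<le> 1"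
    "\<And>u v. 0 \<le> u \<Longrightarrow> u \<le> v \<Longrightarrow> v \<le> 1 \<Longrightarrow> g u \<le> g v"
  using assms unfolding distortion_def Pi_iff mono_on_def by auto

lemma distortion_cong:
  assumes "distortion g" "\<And>u. 0 \<le> u \<Longrightarrow> u \<le> 1 \<Longrightarrow> h u = g u"
  shows "distortion h"
  using assms unfolding distortion_def Pi_iff mono_on_def by auto

lemma distortion_id: "distortion (\<lambda>u. u)"
  unfolding distortion_def by (auto simp: mono_on_def)

lemma distortion_comp:
  assumes "distortion g" "distortion h"
  shows "distortion (\<lambda>u. g (h u))"
  using assms unfolding distortion_def Pi_iff mono_on_def by auto

lemma distortion_prod:
  assumes "finite A" "A \<noteq> {}" "\<And>i. i \<in> A \<Longrightarrow> distortion (g i)"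
  shows "distortion (\<lambda>u. \<Prod>i\<in>A. g i u)"
  unfolding distortion_def
proof (intro conjI)
  show "(\<lambda>u. \<Prod>i\<in>A. g i u) \<in> {0..1} \<rightarrow> {0..1}"
    using distortionD[OF assms(3)] by (auto intro!: prod_nonneg prod_le_1)
  show "mono_on {0..1} (\<lambda>u. \<Prod>i\<in>A. g i u)"
    unfolding mono_on_def using distortionD[OF assms(3)] by (auto intro!: prod_mono)
  show "(\<Prod>i\<in>A. g i 0) = 0"
    using assms distortionD(1)[OF assms(3)] by (auto simp: prod_zero_iff)
  show "(\<Prod>i\<in>A. g i 1) = 1"
    using distortionD(2)[OF assms(3)] by simp
qed

lemma class_F_distortion: "f \<in> class_F \<Longrightarrow> distortion f"
  unfolding class_F_def distortion_def by auto

lemma class_F_pos: "f \<in> class_F \<Longrightarrow> 0 < u \<Longrightarrow> u \<le> 1 \<Longrightarrow> 0 < f u"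
  unfolding class_F_def by auto

lemma class_F_quotient_distortion:
  assumes "f \<in> class_F"
  shows "distortion (\<lambda>u. u / f u)"
proof -
  have m: "mono_on {0..1} (\<lambda>u. u / f u)" and f: "f 1 = 1" "f \<in> {0..1} \<rightarrow> {0..1}"
    using assms unfolding class_F_def by auto
  have "u / f u \<le> 1" if "0 \<le> u" "u \<le> 1" for u
    using monotone_onD[OF m, of u 1] that f by auto
  with m f show ?thesis unfolding distortion_def by (auto simp: Pi_iff)
qed

lemma class_F_quotient_mult:
  assumes "f \<in> class_F" "0 \<le> u" "u \<le> 1"
  shows "u / f u * f u = u"
  using class_F_pos[OF assms(1), of u] assms by (cases "u = 0") auto

section \<open>Generalised inverses\<close>

text \<open>The quantile transform of \<open>g\<close>. If \<open>g \<le> 1\<close>, no \<open>u\<close> reaches \<open>g u \<ge> x\<close> for \<open>x > 1\<close>; the value \<open>x\<close> chosen there keeps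
  the function increasing, hence Borel, and exceeds every point of \<open>[0,1]\<close>, so that the
  equivalence of \<open>distortion_inverse_le_iff\<close> needs no exceptional null set.\<close>

definition distortion_inverse :: "(real \<Rightarrow> real) \<Rightarrow> real \<Rightarrow> real" where
  "distortion_inverse g x = (if x > 1 then x else Inf {u \<in> {0..1}. x \<le> g u})"

lemma mono_distortion_inverse:
  assumes "distortion g"
  shows "mono (distortion_inverse g)"
proof (rule monoI)
  fix x y :: real
  assume "x \<le> y"
  have bdd: "bdd_below {u \<in> {0..1}. z \<le> g u}" for z
    by (rule bdd_belowI[of _ 0]) auto
  have one: "1 \<in> {u \<in> {0..1}. z \<le> g u}" if "z \<le> 1" for z
    using that distortionD(2)[OF assms] by simp
  show "distortion_inverse g x \<le> distortion_inverse g y"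
  proof (cases "y > 1")
    case True
    have "Inf {u \<in> {0..1}. x \<le> g u} \<le> 1" if "x \<le> 1"
      by (rule cInf_lower[OF one[OF that] bdd])
    with True \<open>x \<le> y\<close> show ?thesis unfolding distortion_inverse_def by auto
  next
    case False
    have "Inf {u \<in> {0..1}. x \<le> g u} \<le> Inf {u \<in> {0..1}. y \<le> g u}"
      using False \<open>x \<le> y\<close> one[of y] by (intro cInf_superset_mono bdd) auto
    with False \<open>x \<le> y\<close> show ?thesis unfolding distortion_inverse_def by auto
  qed
qed

text \<open>The equivalence amounts to right continuity of \<open>g\<close> at \<open>u\<close>. This follows from the growth condition,
  which says that \<open>g u / u\<close> is decreasing on \<open>(0,1]\<close>. A jump of \<open>g\<close> at \<open>0\<close> remains possible, and
  therefore \<open>u = 0\<close> is excluded.\<close>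

lemma distortion_inverse_le_iff:
  assumes g: "distortion g"
    and cont: "\<And>u v. 0 < u \<Longrightarrow> u \<le> v \<Longrightarrow> v \<le> 1 \<Longrightarrow> g v * u \<le> g u * v"
    and u: "0 < u" "u \<le> 1"
  shows "distortion_inverse g x \<le> u \<longleftrightarrow> x \<le> g u"
proof (cases "x > 1")
  case True
  with u distortionD(4)[OF g, of u] show ?thesis unfolding distortion_inverse_def by auto
next
  case False
  let ?S = "{w \<in> {0..1}. x \<le> g w}"
  have bdd: "bdd_below ?S" by (rule bdd_belowI[of _ 0]) auto
  have ne: "?S \<noteq> {}" using False distortionD(2)[OF g] by (auto intro: exI[of _ 1])
  have "x \<le> g u" if le: "Inf ?S \<le> u"
  proof (cases "u = 1")
    case True
    with False distortionD(2)[OF g] show ?thesis by simp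
  next
    case u1: False
    (* The infimum is only known to be at most u, so x \<le> g v for v > u; the growth condition
       bounds g v by a quantity that tends to g u. *)
    have above: "x \<le> g u * v / u" if v: "u < v" "v \<le> 1" for v
    proof -
      obtain w where "w \<in> ?S" "w < v"
        using cInf_lessD[OF ne, of v] le v by auto
      then have "x \<le> g v" using distortionD(5)[OF g, of w v] v by auto
      also have "\<dots> \<le> g u * v / u" using cont[of u v] u v by (simp add: field_simps)
      finally show ?thesis .
    qed
    have "((\<lambda>v. g u * v / u) \<longlongrightarrow> g u * u / u) (at_right u)"
      using u by (intro tendsto_intros) auto
    moreover have "\<forall>\<^sub>F v in at_right u. x \<le> g u * v / u"
      using above u u1 by (subst eventually_at_right[of u 1]) (auto intro!: exI[of _ 1])
    ultimately have "x \<le> g u * u / u"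
      by (intro tendsto_lowerbound) auto
    with u show ?thesis by simp
  qed
  moreover have "Inf ?S \<le> u" if "x \<le> g u"
    using that u by (intro cInf_lower bdd) auto
  ultimately show ?thesis using False unfolding distortion_inverse_def by auto
qed

text \<open>Writing \<open>a u / u = 1 / b u\<close> for \<open>u > 0\<close>, the claim is that \<open>b\<close> increases. The product form of the
  inequality avoids divisions.\<close>

lemma complementary_distortion_growth:
  assumes "distortion a" "distortion b" "\<And>u. 0 \<le> u \<Longrightarrow> u \<le> 1 \<Longrightarrow> a u * b u = u"
    and "0 < u" "u \<le> v" "v \<le> 1"
  shows "a v * u \<le> a u * v"
proof -
  have "a v * u = a v * a u * b u" using assms by (simp add: mult.assoc)
  also have "\<dots> \<le> a v * a u * b v"
    using assms distortionD[OF assms(1)] distortionD[OF assms(2)]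
    by (intro mult_left_mono mult_nonneg_nonneg) auto
  also have "\<dots> = a u * v" using assms by (metis dual_order.trans less_imp_le mult.commute mult.left_commute)
  finally show ?thesis .
qed

section \<open>Product of two distorted copulas\<close>

lemma measurable_le_vec:
  fixes u :: "real ^ 'n"
  shows "{x. \<forall>j. x $ j \<le> u $ j} \<in> sets borel"
  by (intro borel_closed closed_Collect_all closed_Collect_le continuous_intros)

lemma measurable_le_component:
  shows "{x :: real ^ 'n. x $ j \<le> t} \<in> sets borel"
  by (intro borel_closed closed_Collect_le continuous_intros)

text \<open>A distribution on the line is determined by its distribution function, and that of a uniform
  margin need only be tested on \<open>[0,1]\<close>.\<close>

lemma uniform_margin_iff:
  fixes M :: "(real ^ 'n) measure"
  assumes "prob_space M" and sets: "sets M = sets borel"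
  shows "distr M borel (\<lambda>x. x $ j) = uniform_measure lborel {0..1} \<longleftrightarrow>
    (\<forall>t\<in>{0..1}. measure M {x. x $ j \<le> t} = t)"
proof -
  interpret prob_space M by fact
  have sp: "space M = UNIV" using sets_eq_imp_space_eq[OF sets] by simp
  have X: "(\<lambda>x. x $ j) \<in> borel_measurable M"
    unfolding measurable_cong_sets[OF sets refl]
    by (intro borel_measurable_continuous_onI continuous_intros)
  show ?thesis
  proof
    assume eq: "distr M borel (\<lambda>x. x $ j) = uniform_measure lborel {0..1}"
    show "\<forall>t\<in>{0..1}. measure M {x. x $ j \<le> t} = t"
    proof
      fix t :: real assume t: "t \<in> {0..1}"
      have "measure M {x. x $ j \<le> t} = measure (distr M borel (\<lambda>x. x $ j)) {..t}"
        using X by (simp add: measure_distr sp vimage_def)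
      also have "\<dots> = measure lborel ({0..1} \<inter> {..t}) / measure lborel {0..1::real}"
        unfolding eq by (rule measure_uniform_measure) auto
      also have "{0..1} \<inter> {..t} = {0..t}" using t by auto
      finally show "measure M {x. x $ j \<le> t} = t" using t by simp
    qed
  next
    assume cdf: "\<forall>t\<in>{0..1}. measure M {x. x $ j \<le> t} = t"
    have "distributed M lborel (\<lambda>x. x $ j) (\<lambda>x. indicator {0..1} x / measure lborel {0..1::real})"
      using cdf by (intro uniform_distrI_borel_atLeastAtMost X) (auto simp: sp)
    then have "distr M lborel (\<lambda>x. x $ j) =
        density lborel (\<lambda>x. ennreal (indicator {0..1} x / measure lborel {0..1::real}))"
      by (rule distributed_distr_eq_density)
    also have "\<dots> = uniform_measure lborel {0..1}"
      unfolding uniform_measure_def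
      by (intro arg_cong2[where f=density] refl ext) (auto split: split_indicator)
    also have "distr M lborel (\<lambda>x. x $ j) = distr M borel (\<lambda>x. x $ j)"
      by (intro distr_cong) auto
    finally show "distr M borel (\<lambda>x. x $ j) = uniform_measure lborel {0..1}" .
  qed
qed

lemma copula_iff_margins:
  "copula (C :: real ^ 'n \<Rightarrow> real) \<longleftrightarrow>
    (\<exists>M :: (real ^ 'n) measure. prob_space M \<and> sets M = sets borel \<and>
       (\<forall>j. \<forall>t\<in>{0..1}. measure M {x. x $ j \<le> t} = t) \<and>
       (\<forall>u\<in>unit_cube. C u = measure M {x. \<forall>j. x $ j \<le> u $ j}))"
  unfolding copula_def using uniform_margin_iff by blast

lemma copula_eq_0:
  assumes "copula C" "u \<in> unit_cube" "u $ j = 0"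
  shows "C u = 0"
proof -
  obtain M where M: "prob_space M" "sets M = sets borel"
      "\<And>j t. t \<in> {0..1} \<Longrightarrow> measure M {x. x $ j \<le> t} = t"
      "\<And>u. u \<in> unit_cube \<Longrightarrow> C u = measure M {x. \<forall>j. x $ j \<le> u $ j}"
    using assms(1) unfolding copula_iff_margins by blast
  interpret prob_space M by fact
  have "C u \<le> measure M {x. x $ j \<le> 0}"
    unfolding M(4)[OF assms(2)] using M(2) measurable_le_component assms(3)
    by (intro finite_measure_mono) (auto, metis)
  also have "\<dots> = 0" using M(3)[of 0] by simp
  finally show ?thesis using M(4)[OF assms(2)] by (simp add: antisym)
qed

text \<open>The coordinatewise maximum of \<open>a\<^sub>j\<^sup>- X\<^sub>j\<close> and \<open>b\<^sub>j\<^sup>- Y\<^sub>j\<close> is at most \<open>u\<^sub>j\<close> exactly when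
  \<open>X\<^sub>j \<le> a\<^sub>j u\<^sub>j\<close> and \<open>Y\<^sub>j \<le> b\<^sub>j u\<^sub>j\<close>, as long as \<open>u\<^sub>j > 0\<close>; independence of \<open>X\<close> and \<open>Y\<close> then gives the
  product. On the lower faces of the cube the equivalence may fail, because \<open>a\<^sub>j\<close> or \<open>b\<^sub>j\<close> may jump
  at \<open>0\<close>, but there both sides vanish.\<close>

lemma copula_distorted_mult:
  fixes C D :: "real ^ 'n \<Rightarrow> real" and a b :: "'n \<Rightarrow> real \<Rightarrow> real"
  assumes C: "copula C" and D: "copula D"
    and a: "\<And>j. distortion (a j)" and b: "\<And>j. distortion (b j)"
    and ab: "\<And>j u. 0 \<le> u \<Longrightarrow> u \<le> 1 \<Longrightarrow> a j u * b j u = u"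
  shows "copula (\<lambda>u. C (\<chi> j. a j (u $ j)) * D (\<chi> j. b j (u $ j)))"
proof -
  obtain M where M: "prob_space M" "sets M = sets borel"
      "\<And>j t. t \<in> {0..1} \<Longrightarrow> measure M {x. x $ j \<le> t} = t"
      "\<And>u. u \<in> unit_cube \<Longrightarrow> C u = measure M {x. \<forall>j. x $ j \<le> u $ j}"
    using C unfolding copula_iff_margins by blast
  obtain N where N: "prob_space N" "sets N = sets borel"
      "\<And>j t. t \<in> {0..1} \<Longrightarrow> measure N {x. x $ j \<le> t} = t"
      "\<And>u. u \<in> unit_cube \<Longrightarrow> D u = measure N {x. \<forall>j. x $ j \<le> u $ j}"
    using D unfolding copula_iff_margins by blast
  have spM: "space M = UNIV" and spN: "space N = UNIV"
    using sets_eq_imp_space_eq[OF M(2)] sets_eq_imp_space_eq[OF N(2)] by auto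
  interpret M: prob_space M by fact
  interpret N: prob_space N by fact
  interpret P: pair_prob_space M N ..
  let ?P = "M \<Otimes>\<^sub>M N"
  let ?Z = "\<lambda>(x, y). \<chi> j. max (distortion_inverse (a j) (x $ j)) (distortion_inverse (b j) (y $ j))"
  have pair: "measure ?P (A \<times> B) = measure M A * measure N B"
    if "A \<in> sets borel" "B \<in> sets borel" for A B
    using that M(2) N(2) by (simp add: N.emeasure_pair_measure_Times measure_def enn2real_mult)
  have component: "(\<lambda>x. x $ j) \<in> borel_measurable M" "(\<lambda>x. x $ j) \<in> borel_measurable N" for j
    unfolding measurable_cong_sets[OF M(2) refl] measurable_cong_sets[OF N(2) refl]
    by (intro borel_measurable_continuous_onI continuous_intros)+
  have inverse: "distortion_inverse (a j) \<in> borel_measurable borel"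
      "distortion_inverse (b j) \<in> borel_measurable borel" for j
    using a b by (auto intro!: borel_measurable_mono mono_distortion_inverse)
  have coordinate: "(\<lambda>p. ?Z p $ j) \<in> borel_measurable ?P" for j
  proof -
    have "(\<lambda>p. distortion_inverse (a j) (fst p $ j)) \<in> borel_measurable ?P"
      using measurable_compose[OF measurable_compose[OF measurable_fst component(1)] inverse(1)] .
    moreover have "(\<lambda>p. distortion_inverse (b j) (snd p $ j)) \<in> borel_measurable ?P"
      using measurable_compose[OF measurable_compose[OF measurable_snd component(2)] inverse(2)] .
    ultimately show ?thesis by (simp add: split_beta)
  qed
  have Z: "?Z \<in> borel_measurable ?P"
    by (subst borel_measurable_euclidean_space)
      (use coordinate in \<open>auto simp: Basis_vec_def inner_axis split_beta simp del: vec_lambda_beta\<close>)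
  let ?Q = "distr ?P borel ?Z"
  have Q: "prob_space ?Q" using Z by (rule P.prob_space_distr)
  interpret Q: prob_space ?Q by fact
  have measure_Q: "measure ?Q A = measure ?P (?Z -` A)" if "A \<in> sets borel" for A
    using that Z by (simp add: measure_distr space_pair_measure spM spN)
  have inverse_le: "distortion_inverse (a j) x \<le> u \<longleftrightarrow> x \<le> a j u"
      "distortion_inverse (b j) x \<le> u \<longleftrightarrow> x \<le> b j u"
    if "0 < u" "u \<le> 1" for j x u
  proof -
    have ba: "b j u * a j u = u" if "0 \<le> u" "u \<le> 1" for u
      using ab[OF that] by (simp add: mult.commute)
    show "distortion_inverse (a j) x \<le> u \<longleftrightarrow> x \<le> a j u"
      using complementary_distortion_growth[OF a b ab] that by (rule distortion_inverse_le_iff[OF a])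
    show "distortion_inverse (b j) x \<le> u \<longleftrightarrow> x \<le> b j u"
      using complementary_distortion_growth[OF b a ba] that by (rule distortion_inverse_le_iff[OF b])
  qed
  have margin_pos: "measure ?Q {x. x $ j \<le> t} = t" if t: "0 < t" "t \<le> 1" for j t
  proof -
    have "?Z -` {x. x $ j \<le> t} = {x. x $ j \<le> a j t} \<times> {y. y $ j \<le> b j t}"
      using inverse_le[OF t] by auto
    then have "measure ?Q {x. x $ j \<le> t} = a j t * b j t"
      using t distortionD[OF a] distortionD[OF b]
      by (simp add: measure_Q measurable_le_component pair M(3) N(3))
    also have "\<dots> = t" using ab t by simp
    finally show ?thesis .
  qed
  (* At t = 0 the margin is squeezed between 0 and its values at small positive t. *)
  have margin: "measure ?Q {x. x $ j \<le> t} = t" if t: "t \<in> {0..1}" for j t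
  proof (cases "t = 0")
    case True
    have "measure ?Q {x. x $ j \<le> 0} \<le> 0 + e" if "e > 0" for e
    proof -
      have "measure ?Q {x. x $ j \<le> 0} \<le> measure ?Q {x. x $ j \<le> min e 1}"
        using that measurable_le_component by (intro Q.finite_measure_mono) auto
      also have "\<dots> = min e 1" using that by (intro margin_pos) auto
      finally show ?thesis by simp
    qed
    then have "measure ?Q {x. x $ j \<le> 0} \<le> 0" by (rule field_le_epsilon)
    with True show ?thesis by (simp add: antisym)
  qed (use margin_pos t in auto)
  have "C (\<chi> j. a j (u $ j)) * D (\<chi> j. b j (u $ j)) = measure ?Q {x. \<forall>j. x $ j \<le> u $ j}"
    if u: "u \<in> unit_cube" for u
  proof -
    have cube: "(\<chi> j. a j (u $ j)) \<in> unit_cube" "(\<chi> j. b j (u $ j)) \<in> unit_cube"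
      using u distortionD[OF a] distortionD[OF b] by auto
    show ?thesis
    proof (cases "\<forall>j. u $ j > 0")
      case True
      then have "?Z -` {x. \<forall>j. x $ j \<le> u $ j} =
          {x. \<forall>j. x $ j \<le> (\<chi> j. a j (u $ j)) $ j} \<times> {y. \<forall>j. y $ j \<le> (\<chi> j. b j (u $ j)) $ j}"
        using inverse_le u by auto
      then show ?thesis
        unfolding M(4)[OF cube(1)] N(4)[OF cube(2)] measure_Q[OF measurable_le_vec]
        by (simp only: pair[OF measurable_le_vec measurable_le_vec])
    next
      case False
      then obtain j where j: "u $ j = 0" using u by (auto simp: not_less) (metis antisym)
      have "C (\<chi> j. a j (u $ j)) = 0"
        using j distortionD(1)[OF a] by (intro copula_eq_0[OF C cube(1), of j]) simp
      moreover have "measure ?Q {x. \<forall>j. x $ j \<le> u $ j} \<le> measure ?Q {x. x $ j \<le> 0}"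
        using measurable_le_component j by (intro Q.finite_measure_mono) (auto, metis)
      ultimately show ?thesis using margin[of 0 j] by (simp add: antisym)
    qed
  qed
  with Q margin show ?thesis
    unfolding copula_iff_margins by (intro exI[of _ ?Q]) auto
qed

section \<open>From the recursion to the product\<close>

lemma comp_range_empty: "j < i \<Longrightarrow> comp_range h i j = id"
  unfolding comp_range_def by simp

lemma comp_range_singleton: "comp_range h j j = h j"
  unfolding comp_range_def by simp

lemma comp_range_Suc: "i \<le> Suc j \<Longrightarrow> comp_range h i (Suc j) = comp_range h i j \<circ> h (Suc j)"
proof -
  have foldr_comp: "foldr (\<circ>) hs e = foldr (\<circ>) hs id \<circ> e" for hs and e :: "'a \<Rightarrow> 'a"
    by (induction hs) (auto simp: comp_assoc)
  assume "i \<le> Suc j"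
  then have "comp_range h i (Suc j) = foldr (\<circ>) (map h [i..<Suc j]) (h (Suc j))"
    unfolding comp_range_def by (subst upt_Suc) simp
  also have "\<dots> = comp_range h i j \<circ> h (Suc j)"
    unfolding comp_range_def by (rule foldr_comp)
  finally show ?thesis .
qed

text \<open>The reversal of the index makes \<open>nested_factor f K k\<close> the factor that goes with the \<open>k\<close>-th copula:
  \<open>(f\<^sub>k\<^sub>+\<^sub>1 \<circ> \<cdots> \<circ> f\<^sub>K) / (f\<^sub>k \<circ> \<cdots> \<circ> f\<^sub>K)\<close>.\<close>

definition nested_factor :: "(nat \<Rightarrow> 'n \<Rightarrow> real \<Rightarrow> real) \<Rightarrow> nat \<Rightarrow> nat \<Rightarrow> 'n \<Rightarrow> real \<Rightarrow> real" where
  "nested_factor f K k j = liebscher_g f j (K - k + 1) K"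

lemma nested_factor_last: "nested_factor f K K j u = u / f K j u"
  unfolding nested_factor_def liebscher_g_def by simp

text \<open>Numerator and denominator both end with \<open>f\<^sub>K\<^sub>+\<^sub>1\<close> as innermost function. For \<open>k = K\<close> the numerator is
  \<open>f\<^sub>K\<^sub>+\<^sub>1\<close> itself, and the quotient is \<open>Id / f\<^sub>K\<close> evaluated there.\<close>

lemma nested_factor_Suc:
  assumes "1 \<le> k" "k \<le> K"
  shows "nested_factor f (Suc K) k j u = nested_factor f K k j (f (Suc K) j u)"
proof (cases "k = K")
  case True
  then show ?thesis
    using assms unfolding nested_factor_def liebscher_g_def
    by (simp add: comp_range_Suc comp_range_empty comp_range_singleton)
next
  case False
  then have "Suc K - k + 1 \<noteq> 1" "Suc K - (Suc K - k + 1) + 2 = Suc k" "Suc K - (Suc K - k + 1) + 1 = k"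
    "K - k + 1 \<noteq> 1" "K - (K - k + 1) + 2 = Suc k" "K - (K - k + 1) + 1 = k"
    using assms by auto
  then show ?thesis
    using assms False unfolding nested_factor_def liebscher_g_def
    by (simp only: if_False) (simp add: comp_range_Suc)
qed

text \<open>Passing from \<open>K\<close> to \<open>K + 1\<close> precomposes the old factors with \<open>f\<^sub>K\<^sub>+\<^sub>1\<close>, so their product becomes
  \<open>f\<^sub>K\<^sub>+\<^sub>1\<close>; the new factor \<open>Id / f\<^sub>K\<^sub>+\<^sub>1\<close> restores the identity.\<close>

lemma nested_factors_properties:
  assumes f1: "\<And>j u. 0 \<le> u \<Longrightarrow> u \<le> 1 \<Longrightarrow> f 1 j u = 1" and f: "\<And>k j. k \<ge> 2 \<Longrightarrow> f k j \<in> class_F"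
    and K: "K \<ge> 1"
  shows "(\<forall>k\<in>{1..K}. \<forall>j. distortion (nested_factor f K k j)) \<and>
    (\<forall>j. \<forall>u\<in>{0..1}. (\<Prod>k=1..K. nested_factor f K k j u) = u)"
  using K
proof (induction K rule: nat_induct_at_least)
  case base
  have eq: "nested_factor f 1 1 j u = u" if "0 \<le> u" "u \<le> 1" for j u
    using that f1 by (simp add: nested_factor_last)
  then show ?case using distortion_cong[OF distortion_id] by auto
next
  case (Suc K)
  have F: "f (Suc K) j \<in> class_F" for j using f Suc.hyps by simp
  have "distortion (nested_factor f (Suc K) k j)" if "k \<in> {1..Suc K}" for k j
  proof (cases "k = Suc K")
    case True
    then show ?thesis
      using class_F_quotient_distortion[OF F, of j] nested_factor_last[of f "Suc K" j]
      by (auto intro: distortion_cong)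
  next
    case False
    then have k: "k \<in> {1..K}" using that by auto
    then have "distortion (nested_factor f K k j)" using Suc.IH by blast
    then have "distortion (\<lambda>u. nested_factor f K k j (f (Suc K) j u))"
      using class_F_distortion[OF F] by (rule distortion_comp)
    moreover have "nested_factor f (Suc K) k j = (\<lambda>u. nested_factor f K k j (f (Suc K) j u))"
      using k by (intro ext nested_factor_Suc) auto
    ultimately show ?thesis by simp
  qed
  moreover have "(\<Prod>k=1..Suc K. nested_factor f (Suc K) k j u) = u" if u: "u \<in> {0..1}" for j u
  proof -
    have "f (Suc K) j u \<in> {0..1}" using distortionD[OF class_F_distortion[OF F]] u by auto
    then have "(\<Prod>k=1..K. nested_factor f K k j (f (Suc K) j u)) = f (Suc K) j u"
      using Suc.IH by blast
    moreover have "(\<Prod>k=1..K. nested_factor f (Suc K) k j u) =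
        (\<Prod>k=1..K. nested_factor f K k j (f (Suc K) j u))"
      by (intro prod.cong refl nested_factor_Suc) auto
    ultimately have "(\<Prod>k=1..K. nested_factor f (Suc K) k j u) = f (Suc K) j u"
      by simp
    then show ?thesis
      using u class_F_quotient_mult[OF F, of u j] by (simp add: nested_factor_last)
  qed
  ultimately show ?case by blast
qed

lemma iter_copula_Suc:
  "K \<ge> 1 \<Longrightarrow> iter_copula C f (Suc K) u =
    C (Suc K) (\<chi> j. u $ j / f (Suc K) j (u $ j)) * iter_copula C f K (\<chi> j. f (Suc K) j (u $ j))"
  by (cases K) auto

lemma iter_copula_eq_prod:
  assumes f1: "\<And>j u. 0 \<le> u \<Longrightarrow> u \<le> 1 \<Longrightarrow> f 1 j u = 1" and f: "\<And>k j. k \<ge> 2 \<Longrightarrow> f k j \<in> class_F"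
    and K: "K \<ge> 1" and u: "u \<in> unit_cube"
  shows "iter_copula C f K u = (\<Prod>k=1..K. C k (\<chi> j. nested_factor f K k j (u $ j)))"
  using K u
proof (induction K arbitrary: u rule: nat_induct_at_least)
  case base
  then have "(\<chi> j. nested_factor f 1 1 j (u $ j)) = u"
    using f1 by (simp add: vec_eq_iff nested_factor_last)
  then show ?case by simp
next
  case (Suc K)
  have "(\<chi> j. f (Suc K) j (u $ j)) \<in> unit_cube"
    using Suc.prems Suc.hyps distortionD[OF class_F_distortion[OF f]] by auto
  then show ?case
    using Suc.hyps Suc.IH by (simp add: iter_copula_Suc nested_factor_last nested_factor_Suc)
qed

lemma copula_iter_copula:
  assumes C: "\<And>k. k \<ge> 1 \<Longrightarrow> copula (C k)" and f: "\<And>k j. k \<ge> 2 \<Longrightarrow> f k j \<in> class_F"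
    and K: "K \<ge> 1"
  shows "copula (iter_copula C f K)"
  using K
proof (induction K rule: nat_induct_at_least)
  case base
  have "iter_copula C f 1 = C 1" by (rule ext) simp
  then show ?case using C by simp
next
  case (Suc K)
  have F: "f (Suc K) j \<in> class_F" for j using f Suc.hyps by simp
  have "copula (\<lambda>u. C (Suc K) (\<chi> j. u $ j / f (Suc K) j (u $ j)) *
      iter_copula C f K (\<chi> j. f (Suc K) j (u $ j)))"
    using C Suc class_F_quotient_distortion[OF F] class_F_distortion[OF F] class_F_quotient_mult[OF F]
    by (intro copula_distorted_mult[where a = "\<lambda>j u. u / f (Suc K) j u" and b = "\<lambda>j. f (Suc K) j"]) auto
  moreover have "iter_copula C f (Suc K) = (\<lambda>u. C (Suc K) (\<chi> j. u $ j / f (Suc K) j (u $ j)) *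
      iter_copula C f K (\<chi> j. f (Suc K) j (u $ j)))"
    using Suc.hyps by (intro ext iter_copula_Suc)
  ultimately show ?case by simp
qed

lemma liebscher_copula_iter_copula:
  assumes C: "\<And>k. k \<ge> 1 \<Longrightarrow> copula (C k)"
    and f1: "\<And>j u. 0 \<le> u \<Longrightarrow> u \<le> 1 \<Longrightarrow> f 1 j u = 1" and f: "\<And>k j. k \<ge> 2 \<Longrightarrow> f k j \<in> class_F"
    and K: "K \<ge> 1"
  shows "liebscher_copula (iter_copula C f K)"
proof -
  note factors = nested_factors_properties[where f = f, OF f1 f K]
  have "copula (iter_copula C f K)" using C f K by (rule copula_iter_copula)
  moreover have "\<forall>u\<in>unit_cube. iter_copula C f K u = (\<Prod>k=1..K. C k (\<chi> j. nested_factor f K k j (u $ j)))"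
    using iter_copula_eq_prod[where f = f, OF f1 f K] by blast
  moreover have "\<forall>k\<in>{1..K}. copula (C k)" using C by simp
  ultimately show ?thesis
    using K factors unfolding liebscher_copula_def distortion_def by blast
qed

section \<open>From the product to the recursion\<close>

text \<open>Where \<open>f\<close> has to satisfy \<open>f (a u * b u) = a u\<close> it is determined, but \<open>a b\<close> may skip values below
  \<open>1\<close>, and \<open>f\<close> must be extended to them within the class. The value at \<open>x > 0\<close> is taken as the infimum
  over \<open>v\<close> of \<open>max (a v) (x / b v)\<close>. For fixed \<open>v\<close> this is increasing in \<open>x\<close>, and its quotient by \<open>x\<close>
  is decreasing; both properties pass to the infimum, which gives that \<open>f\<close> and \<open>Id / f\<close> increase.
  At \<open>x = a u * b u\<close> the term \<open>v = u\<close> equals \<open>a u\<close>, and no other term is smaller: for \<open>v \<ge> u\<close> since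
  \<open>a v \<ge> a u\<close>, and for \<open>v \<le> u\<close> since \<open>x / b v \<ge> x / b u\<close>.\<close>

lemma class_F_factorisation:
  assumes a: "distortion a" and b: "distortion b"
    and apos: "\<And>u. 0 < u \<Longrightarrow> u \<le> 1 \<Longrightarrow> 0 < a u" and bpos: "\<And>u. 0 < u \<Longrightarrow> u \<le> 1 \<Longrightarrow> 0 < b u"
  obtains f where "f \<in> class_F" "\<And>u. 0 \<le> u \<Longrightarrow> u \<le> 1 \<Longrightarrow> f (a u * b u) = a u"
proof -
  define m where "m x v = max (a v) (x / b v)" for x v
  define f where "f x = (if x \<le> 0 then 0 else INF v\<in>{0<..1}. m x v)" for x :: real
  (* Because b \<le> 1; this bound makes f positive on (0,1]. *)
  have ge: "x \<le> m x v" if "0 \<le> x" "v \<in> {0<..1}" for x v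
  proof -
    have "x * b v \<le> x" using that distortionD(4)[OF b, of v] by (intro mult_left_le) auto
    then have "x \<le> x / b v" using that bpos[of v] by (simp add: field_simps)
    then show ?thesis unfolding m_def by simp
  qed
  have bdd: "bdd_below (m x ` {0<..1})" if "0 \<le> x" for x
    using ge[OF that] by (auto intro!: bdd_belowI[of _ x])
  have lower: "f x \<le> m x v" if "0 < x" "v \<in> {0<..1}" for x v
    using that bdd[of x] unfolding f_def by (auto intro!: cINF_lower)
  have greatest: "z \<le> f x" if "0 < x" "\<And>v. v \<in> {0<..1} \<Longrightarrow> z \<le> m x v" for x z
    using that unfolding f_def by (auto intro!: cINF_greatest)
  have m1: "m x 1 = 1" if "x \<le> 1" for x
    using that distortionD(2)[OF a] distortionD(2)[OF b] unfolding m_def by simp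
  have f0: "f 0 = 0" unfolding f_def by simp
  have f_ge: "x \<le> f x" if "0 < x" for x
    using that by (intro greatest ge) auto
  have f_le_1: "f x \<le> 1" if "0 < x" "x \<le> 1" for x
    using lower[of x 1] m1 that by simp
  have nonneg: "0 \<le> f x" for x
    using f_ge[of x] unfolding f_def by (auto split: if_splits)
  have mono: "f x \<le> f y" if "0 < x" "x \<le> y" for x y
  proof (rule greatest)
    fix v :: real assume v: "v \<in> {0<..1}"
    have "f x \<le> m x v" using that v by (intro lower)
    also have "\<dots> \<le> m y v"
      unfolding m_def using that v bpos[of v] by (intro max.mono divide_right_mono) auto
    finally show "f x \<le> m y v" .
  qed (use that in auto)
  have quotient_mono: "x / f x \<le> y / f y" if "0 < x" "x \<le> y" for x y
  proof -
    have "f y * x / y \<le> f x"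
    proof (rule greatest)
      fix v :: real assume v: "v \<in> {0<..1}"
      have "f y * x \<le> m y v * x" using that v by (intro mult_right_mono lower) auto
      also have "\<dots> \<le> m x v * y"
        using that v apos[of v] bpos[of v] unfolding m_def
        by (auto simp: max_def field_simps intro: mult_left_mono)
      finally show "f y * x / y \<le> m x v" using that by (simp add: field_simps)
    qed (use that in auto)
    then show ?thesis using f_ge[of x] f_ge[of y] that by (simp add: field_simps)
  qed
  have "f \<in> class_F"
    unfolding class_F_def mem_Collect_eq
  proof (intro conjI)
    show "f 1 = 1" using f_ge[of 1] f_le_1[of 1] by simp
    show "f 0 = 0" by fact
    show "mono_on {0..1} f"
    proof (rule mono_onI)
      fix x y :: real assume "x \<in> {0..1}" "y \<in> {0..1}" "x \<le> y"
      then show "f x \<le> f y" using mono f0 nonneg by (cases "x = 0") auto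
    qed
    show "mono_on {0..1} (\<lambda>u. u / f u)"
    proof (rule mono_onI)
      fix x y :: real assume "x \<in> {0..1}" "y \<in> {0..1}" "x \<le> y"
      then show "x / f x \<le> y / f y" using quotient_mono nonneg by (cases "x = 0") auto
    qed
    show "f \<in> {0..1} \<rightarrow> {0..1}"
    proof
      fix u :: real assume "u \<in> {0..1}"
      then show "f u \<in> {0..1}" using f_le_1[of u] nonneg[of u] f0 by (cases "u = 0") auto
    qed
    show "\<forall>u\<in>{0<..1}. f u > 0"
    proof
      fix u :: real assume "u \<in> {0<..1}"
      then show "f u > 0" using f_ge[of u] by auto
    qed
  qed
  moreover have "f (a u * b u) = a u" if u: "0 \<le> u" "u \<le> 1" for u
  proof (cases "u = 0")
    case True
    then show ?thesis using f0 distortionD(1)[OF a] by simp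
  next
    case False
    then have u: "0 < u" "u \<le> 1" using u by auto
    note pos = apos[OF u] bpos[OF u]
    show ?thesis
    proof (rule antisym)
      have "m (a u * b u) u = a u" using pos unfolding m_def by simp
      then show "f (a u * b u) \<le> a u" using lower[of "a u * b u" u] u pos by simp
      show "a u \<le> f (a u * b u)"
      proof (rule greatest)
        fix v :: real assume v: "v \<in> {0<..1}"
        show "a u \<le> m (a u * b u) v"
        proof (cases "u \<le> v")
          case True
          then show ?thesis using v u distortionD(5)[OF a, of u v] unfolding m_def by auto
        next
          case False
          then have "a u * b v \<le> a u * b u"
            using v u pos distortionD(5)[OF b, of v u] by (intro mult_left_mono) auto
          then have "a u \<le> a u * b u / b v" using v bpos[of v] by (simp add: field_simps)
          then show ?thesis unfolding m_def by simp
        qed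
      qed (use pos in simp)
    qed
  qed
  ultimately show thesis by (rule that)
qed

text \<open>The functions \<open>f\<^sub>k\<close> come from factorising the partial products \<open>P\<^sub>k = P\<^sub>k\<^sub>-\<^sub>1 g\<^sub>k\<close>. The recursion is then
  evaluated by induction on \<open>k\<close> at the points with coordinates \<open>P\<^sub>k u\<^sub>j\<close>, which are the \<open>u\<^sub>j\<close> themselves
  when \<open>k = K\<close>.\<close>

lemma liebscher_copula_is_iter_copula:
  assumes "liebscher_copula (L :: real ^ 'n \<Rightarrow> real)"
  shows "\<exists>K\<ge>1. \<exists>(C :: nat \<Rightarrow> real ^ 'n \<Rightarrow> real) (f :: nat \<Rightarrow> 'n \<Rightarrow> real \<Rightarrow> real).
    (\<forall>k\<in>{1..K}. copula (C k)) \<and> (\<forall>j. \<forall>u\<in>{0..1}. f 1 j u = 1) \<and>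
    (\<forall>k\<in>{2..K}. \<forall>j. f k j \<in> class_F) \<and> (\<forall>u\<in>unit_cube. L u = iter_copula C f K u)"
proof -
  obtain K :: nat and C :: "nat \<Rightarrow> real ^ 'n \<Rightarrow> real" and g :: "nat \<Rightarrow> 'n \<Rightarrow> real \<Rightarrow> real"
    where K: "K \<ge> 1" and C: "\<And>k. k \<in> {1..K} \<Longrightarrow> copula (C k)"
    and g: "\<And>k j. k \<in> {1..K} \<Longrightarrow> distortion (g k j)"
    and g_prod: "\<And>j u. u \<in> {0..1} \<Longrightarrow> (\<Prod>k=1..K. g k j u) = u"
    and L: "\<And>u. u \<in> unit_cube \<Longrightarrow> L u = (\<Prod>k=1..K. C k (\<chi> j. g k j (u $ j)))"
    using assms unfolding liebscher_copula_def distortion_def[symmetric] by blast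
  define P where "P k j u = (\<Prod>i=1..k. g i j u)" for k :: nat and j u
  (* A vanishing factor would make the whole product, which is u, vanish. *)
  have g_pos: "0 < g k j u" if "k \<in> {1..K}" "0 < u" "u \<le> 1" for k j u
  proof -
    have "(\<Prod>k=1..K. g k j u) \<noteq> 0" using g_prod[of u j] that by simp
    then have "g k j u \<noteq> 0" using that by (simp add: prod_zero_iff)
    then show ?thesis using distortionD(3)[OF g[OF that(1)], of u j] that by simp
  qed
  have P: "distortion (P k j)" if "k \<in> {1..K}" for k j
    unfolding P_def using that g by (intro distortion_prod) auto
  have P_pos: "0 < P k j u" if "k \<le> K" "0 < u" "u \<le> 1" for k j u
    unfolding P_def using that g_pos by (intro prod_pos) auto
  have P_Suc: "P (Suc k) j u = P k j u * g (Suc k) j u" for k j u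
    unfolding P_def by simp
  have "\<exists>h. h \<in> class_F \<and> (\<forall>u\<in>{0..1}. h (P (Suc k) j u) = P k j u)" if "k \<in> {1..<K}" for k j
  proof -
    have k: "k \<in> {1..K}" "Suc k \<in> {1..K}" "k \<le> K" using that by auto
    obtain h where "h \<in> class_F" "\<And>u. 0 \<le> u \<Longrightarrow> u \<le> 1 \<Longrightarrow> h (P k j u * g (Suc k) j u) = P k j u"
      using class_F_factorisation[OF P[OF k(1)] g[OF k(2)] P_pos[OF k(3)] g_pos[OF k(2)]] by blast
    then show ?thesis unfolding P_Suc by auto
  qed
  then obtain h where h: "\<And>k j. k \<in> {1..<K} \<Longrightarrow> h k j \<in> class_F"
    "\<And>k j u. k \<in> {1..<K} \<Longrightarrow> u \<in> {0..1} \<Longrightarrow> h k j (P (Suc k) j u) = P k j u"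
    by metis
  define f where "f k j = (if k = 1 then \<lambda>_. 1 else h (k - 1) j)" for k j
  have iter: "iter_copula C f k (\<chi> j. P k j (u $ j)) = (\<Prod>i=1..k. C i (\<chi> j. g i j (u $ j)))"
    if u: "u \<in> unit_cube" and "1 \<le> k" "k \<le> K" for u k
    using that(2,3)
  proof (induction k rule: nat_induct_at_least)
    case base
    show ?case by (simp add: P_def)
  next
    case (Suc k)
    then have k: "k \<in> {1..<K}" by simp
    have fP: "f (Suc k) j (P (Suc k) j (u $ j)) = P k j (u $ j)" for j
      using h(2)[OF k, of "u $ j" j] u k unfolding f_def by auto
    have quotient: "P (Suc k) j (u $ j) / P k j (u $ j) = g (Suc k) j (u $ j)" for j
    (* At 0 both sides are 0, the left one as the quotient 0 / 0. *)
    proof (cases "u $ j = 0")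
      case True
      then show ?thesis using k distortionD(1)[OF g] distortionD(1)[OF P] by simp
    next
      case False
      moreover have "0 \<le> u $ j" "u $ j \<le> 1" using u by auto
      ultimately show ?thesis using P_pos[of k "u $ j" j] k by (simp add: P_Suc)
    qed
    show ?case
      using Suc by (simp add: iter_copula_Suc fP quotient)
  qed
  have "L u = iter_copula C f K u" if u: "u \<in> unit_cube" for u
  proof -
    have "(\<chi> j. P K j (u $ j)) = u"
      using g_prod u unfolding P_def by (simp add: vec_eq_iff)
    then show ?thesis using iter[OF u K] L[OF u] by simp
  qed
  moreover have "f k j \<in> class_F" if "k \<in> {2..K}" for k j
  proof -
    have "k - 1 \<in> {1..<K}" "k \<noteq> 1" using that by auto
    then show ?thesis using h(1) unfolding f_def by simp
  qed
  moreover have "f 1 j u = 1" for j u unfolding f_def by simp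
  ultimately show ?thesis using K C by blast
qed

section \<open>Equivalence of the two constructions\<close>

theorem proposition5:
  assumes "CARD('n::finite) \<ge> 2"
  shows
    "(\<forall>(C :: nat \<Rightarrow> real ^ 'n \<Rightarrow> real) (f :: nat \<Rightarrow> 'n \<Rightarrow> real \<Rightarrow> real).
        (\<forall>k\<ge>1. copula (C k)) \<and>
        (\<forall>j. \<forall>u\<in>{0..1}. f 1 j u = 1) \<and>
        (\<forall>k\<ge>2. \<forall>j. f k j \<in> class_F) \<longrightarrow>
        (\<forall>K\<ge>1. liebscher_copula (iter_copula C f K) \<and>
           (\<forall>u\<in>unit_cube. iter_copula C f K u =
              (\<Prod>k=1..K. C k (\<chi> j. liebscher_g f j (K - k + 1) K (u $ j)))))) \<and>
     (\<forall>L :: real ^ 'n \<Rightarrow> real. liebscher_copula L \<longrightarrow>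
        (\<exists>K\<ge>1. \<exists>(C :: nat \<Rightarrow> real ^ 'n \<Rightarrow> real) (f :: nat \<Rightarrow> 'n \<Rightarrow> real \<Rightarrow> real).
           (\<forall>k\<in>{1..K}. copula (C k)) \<and>
           (\<forall>j. \<forall>u\<in>{0..1}. f 1 j u = 1) \<and>
           (\<forall>k\<in>{2..K}. \<forall>j. f k j \<in> class_F) \<and>
           (\<forall>u\<in>unit_cube. L u = iter_copula C f K u)))"
proof (intro conjI allI impI)
  fix C :: "nat \<Rightarrow> real ^ 'n \<Rightarrow> real" and f :: "nat \<Rightarrow> 'n \<Rightarrow> real \<Rightarrow> real" and K :: nat
  assume asm: "(\<forall>k\<ge>1. copula (C k)) \<and> (\<forall>j. \<forall>u\<in>{0..1}. f 1 j u = 1) \<and> (\<forall>k\<ge>2. \<forall>j. f k j \<in> class_F)"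
    and K: "1 \<le> K"
  then show "liebscher_copula (iter_copula C f K)"
    by (intro liebscher_copula_iter_copula) auto
  show "\<forall>u\<in>unit_cube. iter_copula C f K u =
      (\<Prod>k=1..K. C k (\<chi> j. liebscher_g f j (K - k + 1) K (u $ j)))"
    using asm K iter_copula_eq_prod[where f = f and K = K and C = C] unfolding nested_factor_def by auto
qed (rule liebscher_copula_is_iter_copula)

end
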